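(* In the codimension-one setting described in the context, let $\beta\in V_{\mathbb{C}}$. Then $E'_\beta$ is nonempty and $$\sum_{v\in E'_\beta} m_v=\sum_{i=1}^k\ell_i .$$
   Context: Setting: $A=\{\mathbf{a}_1,\dots,\mathbf{a}_n\}\subseteq\mathbb{Z}^d$, $V\subseteq\mathbb{R}^d$ is the real span of $A$ and $V_{\mathbb{C}}\subseteq\mathbb{C}^d$ is its complex span. It is assumed that $\dim V=n-1$ and that each subset of $A$ of cardinality $n-1$ is linearly independent. The lattice of integer relations on $A$ is generated by a single relation $\sum_{i=1}^k \ell_i\mathbf{a}_i-\sum_{j=k+1}^n\ell_j\mathbf{a}_j=\mathbf{0}$, where $1\le k\le n$ and $\ell_1,\dots,\ell_n$ are relatively prime positive integers. For $\beta\in V_{\mathbb{C}}$, $i\in\{1,\dots,k\}$ and $b\in\{0,1,\dots,\ell_i-1\}$, let $v^{(i,b)}\in\mathbb{C}^n$ be the unique vector with $v^{(i,b)}_i=b$ and $\sum_{\mu=1}^n v^{(i,b)}_\mu\mathbf{a}_\mu=\beta$. Put $E_\beta=\{v^{(i,b)}\mid 1\le i\le k,\ 0\le b\le \ell_i-1\}$ (a set, so coinciding vectors are counted once) and $E'_\beta=\{v\in E_\beta\mid v_i\notin\mathbb{Z}_{<0}\text{ for }i=1,\dots,k\}$. For $v\in E'_\beta$ put $M_v=\{i\in\{1,\dots,k\}\mid v_i\in\mathbb{Z}_{\ge0}\}$ and $m_v=|M_v|$ (the multiplicity of $v$). *)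

theory Defs
  imports "HOL-Analysis.Analysis"
begin

definition of_int_vec :: "int ^ 'd \<Rightarrow> 'a::ring_1 ^ 'd" where
  "of_int_vec x = (\<chi> j. of_int (x $ j))"

text \<open>
  Vectors with coordinates indexed by \<open>1, \<dots>, n\<close> are functions on \<^typ>\<open>nat\<close> that are
  extensional on \<open>{1..n}\<close>, so that equality of functions is equality of vectors.
\<close>

definition relation_lattice :: "nat \<Rightarrow> (nat \<Rightarrow> int ^ 'd) \<Rightarrow> (nat \<Rightarrow> int) set" where
  "relation_lattice n a = {c \<in> extensional {1..n}. (\<Sum>i=1..n. c i *s a i) = 0}"

definition real_span :: "nat \<Rightarrow> (nat \<Rightarrow> int ^ 'd) \<Rightarrow> (real ^ 'd) set" where
  "real_span n a = span ((\<lambda>i. of_int_vec (a i)) ` {1..n})"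

text \<open>
  The constant \<open>span\<close> on \<open>complex ^ 'd\<close> would be the span over the reals; \<open>vec.span\<close> is the
  span with respect to \<open>*s\<close>, i.e. over the complex numbers.
\<close>

definition complex_span :: "nat \<Rightarrow> (nat \<Rightarrow> int ^ 'd) \<Rightarrow> (complex ^ 'd) set" where
  "complex_span n a = vec.span ((\<lambda>i. of_int_vec (a i)) ` {1..n})"

definition exponent ::
  "nat \<Rightarrow> (nat \<Rightarrow> int ^ 'd) \<Rightarrow> complex ^ 'd \<Rightarrow> nat \<Rightarrow> nat \<Rightarrow> (nat \<Rightarrow> complex)" where
  "exponent n a \<beta> i b =
     (THE v. v \<in> extensional {1..n} \<and> v i = of_nat b \<and>
             (\<Sum>\<mu>=1..n. v \<mu> *s of_int_vec (a \<mu>)) = \<beta>)"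

definition exponents ::
  "nat \<Rightarrow> nat \<Rightarrow> (nat \<Rightarrow> nat) \<Rightarrow> (nat \<Rightarrow> int ^ 'd) \<Rightarrow> complex ^ 'd \<Rightarrow> (nat \<Rightarrow> complex) set" where
  "exponents n k l a \<beta> = {exponent n a \<beta> i b | i b. i \<in> {1..k} \<and> b \<in> {0..<l i}}"

definition exponents' ::
  "nat \<Rightarrow> nat \<Rightarrow> (nat \<Rightarrow> nat) \<Rightarrow> (nat \<Rightarrow> int ^ 'd) \<Rightarrow> complex ^ 'd \<Rightarrow> (nat \<Rightarrow> complex) set" where
  "exponents' n k l a \<beta> =
     {v \<in> exponents n k l a \<beta>. \<forall>i\<in>{1..k}. v i \<notin> of_int ` {..<0}}"

text \<open>The set \<open>\<nat>\<close> contains \<open>0\<close>.\<close>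

definition nonneg_int_indices :: "nat \<Rightarrow> (nat \<Rightarrow> complex) \<Rightarrow> nat set" where
  "nonneg_int_indices k v = {i \<in> {1..k}. v i \<in> \<nat>}"

definition exponent_multiplicity :: "nat \<Rightarrow> (nat \<Rightarrow> complex) \<Rightarrow> nat" where
  "exponent_multiplicity k v = card (nonneg_int_indices k v)"

end

theory Submission
  imports Defs
begin

text \<open>
  Let \<open>L = (\<ell>\<^sub>1, \<dots>, \<ell>\<^sub>k, -\<ell>\<^bsub>k+1\<^esub>, \<dots>, -\<ell>\<^sub>n)\<close>. Since any \<open>n - 1\<close> of the vectors are independent,
  the complex relations are exactly the multiples of \<open>L\<close>, so the solutions \<open>v\<close> of
  \<open>\<Sum> v\<^sub>\<mu> a\<^sub>\<mu> = \<beta>\<close> form a complex line \<open>v\<^sub>0 + t L\<close>. Everything then becomes a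
  statement about the parameters \<open>t\<close> and the first \<open>k\<close> coordinates \<open>p\<^sub>i + t \<ell>\<^sub>i\<close>.

  Sort the parameters into classes modulo \<open>\<int>\<close>. Within one class the set \<open>J\<close> of those
  \<open>i \<le> k\<close> for which the \<open>i\<close>-th coordinate is an integer is constant. A parameter of the class
  gives an element of \<open>E'\<^sub>\<beta>\<close> iff all coordinates in \<open>J\<close> are nonnegative while at least one of
  them drops below zero when \<open>t\<close> is decreased by one. So if \<open>J\<close> is nonempty, the class
  contains precisely one such parameter, the first one at which all coordinates in \<open>J\<close> are
  nonnegative (\<open>ex_admissible_translate\<close>, \<open>admissible_translate_unique\<close>), and its
  multiplicity is \<open>card J\<close>. Counting pairs of a class and an index in \<open>J\<close> the other way round,
  an index \<open>i\<close> is counted once for each residue of the \<open>i\<close>-th coordinate modulo \<open>\<ell>\<^sub>i\<close>, that is,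
  \<open>\<ell>\<^sub>i\<close> times (\<open>card_admissible_Nats\<close>). The total is \<open>\<Sum> \<ell>\<^sub>i\<close>, and since this is positive,
  \<open>E'\<^sub>\<beta>\<close> cannot be empty.
\<close>

section \<open>Integer points on a line with positive integral direction\<close>

locale integral_line =
  fixes I :: "'i set" and l :: "'i \<Rightarrow> nat" and p :: "'i \<Rightarrow> complex"
  assumes finite_I: "finite I" and l_pos: "i \<in> I \<Longrightarrow> 0 < l i"
begin

definition coord :: "'i \<Rightarrow> complex \<Rightarrow> complex" where
  "coord i t = p i + t * of_nat (l i)"

definition starts :: "complex set" where
  "starts = {t. \<exists>i\<in>I. \<exists>b<l i. coord i t = of_nat b}"

definition admissible :: "complex set" where
  "admissible = {t \<in> starts. \<forall>i\<in>I. coord i t \<notin> of_int ` {..<0}}"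

lemma coord_add_of_int: "coord i (t + of_int m) = coord i t + of_int (m * int (l i))"
  by (simp add: coord_def algebra_simps)

lemma coord_diff: "coord i s - coord i t = (s - t) * of_nat (l i)"
  by (simp add: coord_def algebra_simps)

lemma finite_starts: "finite starts"
proof -
  have "starts \<subseteq> (\<Union>i\<in>I. \<Union>b\<in>{..<l i}. {(of_nat b - p i) / of_nat (l i)})"
    using l_pos by (fastforce simp: starts_def coord_def field_simps)
  then show ?thesis
    by (rule finite_subset) (use finite_I in auto)
qed

lemma finite_admissible: "finite admissible"
  using finite_starts by (simp add: admissible_def)

text \<open>
  At an element of \<open>starts\<close> some coordinate is smaller than its step, so one unit further
  down the line it is a negative integer.
\<close>
lemma admissible_not_above:
  assumes "t \<in> admissible" "s \<in> admissible" "s = t + of_int m"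
  shows "m \<le> 0"
proof (rule ccontr)
  assume "\<not> m \<le> 0"
  then have m: "1 \<le> m" by simp
  obtain j b where j: "j \<in> I" "b < l j" "coord j s = of_nat b"
    using assms(2) by (auto simp: admissible_def starts_def)
  have "coord j s = coord j t + of_int (m * int (l j))"
    using coord_add_of_int assms(3) by simp
  then have c: "coord j t = of_int (int b - m * int (l j))"
    using j(3) by simp
  have "int (l j) \<le> m * int (l j)"
    using mult_right_mono[OF m, of "int (l j)"] by simp
  then have "int b - m * int (l j) < 0"
    using j(2) by linarith
  then have "coord j t \<in> of_int ` {..<0}"
    unfolding c by (intro imageI) simp
  then show False
    using assms(1) j(1) by (auto simp: admissible_def)
qed

lemma admissible_translate_unique:
  assumes "t \<in> admissible" "s \<in> admissible" "s = t + of_int m"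
  shows "s = t"
proof -
  have "m \<le> 0" by (rule admissible_not_above[OF assms])
  moreover have "- m \<le> 0"
    by (rule admissible_not_above[OF assms(2,1)]) (simp add: assms(3))
  ultimately show ?thesis using assms(3) by simp
qed

text \<open>
  Moving up the line by whole units, stop as soon as no coordinate is a negative integer.
  If at least one step was made, a coordinate that was still a negative integer just before
  stopping now lies below its step, which makes the stopping point an element of \<open>starts\<close>.
\<close>
lemma ex_admissible_translate:
  assumes "t \<in> starts"
  obtains m :: nat where "t + of_nat m \<in> admissible"
proof -
  define Q where "Q m \<longleftrightarrow> (\<forall>j\<in>I. coord j (t + of_nat m) \<notin> of_int ` {..<0})" for m :: nat
  define M where "M = (\<Sum>j\<in>I. nat \<lceil>\<bar>Re (coord j t)\<bar>\<rceil>)"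
  \<comment> \<open>every step is at least 1, so after \<open>M\<close> units all real parts are nonnegative\<close>
  have "Q M"
    unfolding Q_def
  proof
    fix j assume j: "j \<in> I"
    have "nat \<lceil>\<bar>Re (coord j t)\<bar>\<rceil> \<le> M"
      unfolding M_def by (rule member_le_sum) (use j finite_I in auto)
    then have "\<bar>Re (coord j t)\<bar> \<le> real M" by linarith
    also have "real M \<le> real M * real (l j)"
      using l_pos[OF j] by (simp add: mult_le_cancel_left1)
    finally have "0 \<le> Re (coord j (t + of_nat M))"
      using coord_add_of_int[of j t "int M"] by simp
    then show "coord j (t + of_nat M) \<notin> of_int ` {..<0}"
      by auto
  qed
  define m where "m = (LEAST m. Q m)"
  have Qm: "Q m" unfolding m_def by (rule LeastI) (rule \<open>Q M\<close>)
  have "t + of_nat m \<in> starts"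
  proof (cases m)
    case 0
    then show ?thesis using assms by simp
  next
    case (Suc m')
    have "\<not> Q m'"
      using not_less_Least[of m' Q] Suc by (simp add: m_def)
    then obtain j z where j: "j \<in> I" "coord j (t + of_nat m') = of_int z" "z < 0"
      by (auto simp: Q_def)
    have c: "coord j (t + of_nat m) = of_int (z + int (l j))"
      using coord_add_of_int[of j "t + of_nat m'" 1] j(2) Suc by (simp add: add_ac)
    have "0 \<le> z + int (l j)"
      using Qm j(1) c unfolding Q_def by (force simp del: of_int_add)
    then obtain b where b: "z + int (l j) = int b"
      using zero_le_imp_eq_int by blast
    then have "b < l j" using j(3) by linarith
    moreover have "coord j (t + of_nat m) = of_nat b"
      using c b by simp
    ultimately show ?thesis using j(1) by (auto simp: starts_def)
  qed
  with Qm have "t + of_nat m \<in> admissible"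
    by (auto simp: admissible_def Q_def)
  then show thesis by (rule that)
qed

text \<open>
  For fixed \<open>i\<close>, the classes modulo \<open>\<int>\<close> on which the \<open>i\<close>-th coordinate is an integer
  correspond to the residues of that coordinate modulo \<open>l i\<close>, and each such class has
  exactly one admissible member.
\<close>
lemma card_admissible_Nats:
  assumes i: "i \<in> I"
  shows "card {t \<in> admissible. coord i t \<in> \<nat>} = l i"
proof -
  let ?A = "{t \<in> admissible. coord i t \<in> \<nat>}"
  define r where "r t = nat \<lfloor>Re (coord i t)\<rfloor> mod l i" for t
  have r: "r t = b mod l i" if "coord i t = of_nat b" for t b
    using that by (simp add: r_def)
  have "inj_on r ?A"
  proof (rule inj_onI)
    fix t s assume t: "t \<in> ?A" and s: "s \<in> ?A" and eq: "r t = r s"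
    obtain b c where b: "coord i t = of_nat b" and c: "coord i s = of_nat c"
      using t s by (auto elim!: Nats_cases)
    have "b mod l i = c mod l i"
      using eq r[OF b] r[OF c] by simp
    then have "int c mod int (l i) = int b mod int (l i)"
      by (simp only: of_nat_mod[symmetric])
    then have "int (l i) dvd int c - int b"
      by (simp only: mod_eq_dvd_iff)
    then obtain m where m: "int c - int b = int (l i) * m" by (auto elim: dvdE)
    have "(s - t) * of_nat (l i) = of_int (int c - int b)"
      using coord_diff[of i s t] b c by simp
    also have "\<dots> = of_int m * of_nat (l i)"
      by (simp only: m) simp
    finally have "s - t = of_int m"
      using l_pos[OF i] by simp
    then have "s = t + of_int m" by (simp add: algebra_simps)
    then show "t = s"
      using admissible_translate_unique[of t s m] t s by simp
  qed
  moreover have "r ` ?A = {..<l i}"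
  proof
    show "r ` ?A \<subseteq> {..<l i}"
      using l_pos[OF i] by (auto simp: r_def)
    show "{..<l i} \<subseteq> r ` ?A"
    proof
      fix b assume b: "b \<in> {..<l i}"
      define t where "t = (of_nat b - p i) / of_nat (l i)"
      have t: "coord i t = of_nat b"
        using l_pos[OF i] by (simp add: coord_def t_def)
      then have "t \<in> starts" using i b by (auto simp: starts_def)
      then obtain m where m: "t + of_nat m \<in> admissible"
        by (rule ex_admissible_translate)
      have c: "coord i (t + of_nat m) = of_nat (b + m * l i)"
        using coord_add_of_int[of i t "int m"] t by simp
      have "r (t + of_nat m) = b" using r[OF c] b by simp
      moreover have "t + of_nat m \<in> ?A" using m c by (simp del: of_nat_add)
      ultimately show "b \<in> r ` ?A" by blast
    qed
  qed
  ultimately show ?thesis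
    using card_image[of r ?A] by simp
qed

lemma sum_card_admissible:
  "(\<Sum>t\<in>admissible. card {i \<in> I. coord i t \<in> \<nat>}) = (\<Sum>i\<in>I. l i)"
proof -
  have "(\<Sum>t\<in>admissible. card {i \<in> I. coord i t \<in> \<nat>})
      = (\<Sum>t\<in>admissible. \<Sum>i | i \<in> I \<and> coord i t \<in> \<nat>. 1)"
    by simp
  also have "\<dots> = (\<Sum>i\<in>I. \<Sum>t | t \<in> admissible \<and> coord i t \<in> \<nat>. 1)"
    by (rule sum.swap_restrict[OF finite_admissible finite_I])
  also have "\<dots> = (\<Sum>i\<in>I. l i)"
    by (simp add: card_admissible_Nats)
  finally show ?thesis .
qed

end

section \<open>The relations form a line\<close>

lemma of_int_vec_nth [simp]: "of_int_vec x $ j = of_int (x $ j)"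
  by (simp add: of_int_vec_def)

lemma of_int_vec_eq_iff [simp]:
  "(of_int_vec x :: 'a::ring_char_0 ^ 'd) = of_int_vec y \<longleftrightarrow> x = y"
  by (simp add: vec_eq_iff)

text \<open>
  A complex relation among integer vectors splits into two real ones, its real and imaginary
  parts, so real independence is enough.
\<close>
lemma complex_relation_trivial:
  fixes a :: "'i \<Rightarrow> int ^ 'd" and c :: "'i \<Rightarrow> complex"
  assumes "finite J" and inj: "inj_on a J"
    and indep: "independent ((\<lambda>i. of_int_vec (a i) :: real ^ 'd) ` J)"
    and rel: "(\<Sum>i\<in>J. c i *s of_int_vec (a i)) = (0 :: complex ^ 'd)"
    and "i \<in> J"
  shows "c i = 0"
proof -
  have inj': "inj_on (\<lambda>i. of_int_vec (a i) :: real ^ 'd) J"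
    using inj unfolding inj_on_def of_int_vec_eq_iff .
  have real: "r i = 0" if "(\<Sum>i\<in>J. r i *\<^sub>R of_int_vec (a i)) = (0 :: real ^ 'd)" for r
  proof -
    let ?f = "\<lambda>i. of_int_vec (a i) :: real ^ 'd"
    have "(\<Sum>v\<in>?f ` J. r (the_inv_into J ?f v) *\<^sub>R v) = (\<Sum>i\<in>J. r i *\<^sub>R ?f i)"
      by (subst sum.reindex[OF inj'])
         (auto intro!: sum.cong simp: the_inv_into_f_f[OF inj'])
    then have "r (the_inv_into J ?f (?f i)) = 0"
      by (intro independentD[OF indep _ subset_refl])
         (use that \<open>finite J\<close> \<open>i \<in> J\<close> in auto)
    then show ?thesis using the_inv_into_f_f[OF inj' \<open>i \<in> J\<close>] by simp
  qed
  have comp: "(\<Sum>i\<in>J. c i * of_int (a i $ j)) = 0" for j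
    using arg_cong[OF rel, of "\<lambda>v. v $ j"] by simp
  have "Re (c i) = 0"
  proof (rule real)
    show "(\<Sum>i\<in>J. Re (c i) *\<^sub>R of_int_vec (a i)) = (0 :: real ^ 'd)"
      using arg_cong[OF comp, of Re] by (simp add: vec_eq_iff)
  qed
  moreover have "Im (c i) = 0"
  proof (rule real)
    show "(\<Sum>i\<in>J. Im (c i) *\<^sub>R of_int_vec (a i)) = (0 :: real ^ 'd)"
      using arg_cong[OF comp, of Im] by (simp add: vec_eq_iff)
  qed
  ultimately show ?thesis by (simp add: complex_eq_iff)
qed

lemma mem_complex_span_obtain:
  fixes a :: "nat \<Rightarrow> int ^ 'd"
  assumes "\<beta> \<in> complex_span n a" and "inj_on a {1..n}"
  obtains v where "v \<in> extensional {1..n}" "(\<Sum>\<mu>=1..n. v \<mu> *s of_int_vec (a \<mu>)) = \<beta>"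
proof -
  let ?f = "\<lambda>i. of_int_vec (a i) :: complex ^ 'd"
  have inj: "inj_on ?f {1..n}"
    using assms(2) unfolding inj_on_def of_int_vec_eq_iff .
  have "\<beta> \<in> range (\<lambda>u. \<Sum>w\<in>?f ` {1..n}. u w *s w)"
    using assms(1) unfolding complex_span_def by (simp only: vec.span_finite finite_imageI finite_atLeastAtMost)
  then obtain u where "\<beta> = (\<Sum>w\<in>?f ` {1..n}. u w *s w)"
    by (rule rangeE)
  then have "(\<Sum>\<mu>=1..n. restrict (u \<circ> ?f) {1..n} \<mu> *s ?f \<mu>) = \<beta>"
    unfolding sum.reindex[OF inj] by simp
  then show thesis by (intro that[of "restrict (u \<circ> ?f) {1..n}"]) auto
qed

section \<open>The multiplicity formula\<close>

theorem mainTheorem2: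
  fixes n k :: nat
    and a :: "nat \<Rightarrow> int ^ 'd"
    and l :: "nat \<Rightarrow> nat"
    and \<beta> :: "complex ^ 'd"
  assumes "inj_on a {1..n}"
    and "dim (real_span n a) = n - 1"
    and "\<forall>B \<subseteq> (\<lambda>i. of_int_vec (a i) :: real ^ 'd) ` {1..n}. card B = n - 1 \<longrightarrow> independent B"
    and "1 \<le> k" and "k \<le> n"
    and "\<forall>i\<in>{1..n}. 0 < l i"
    and "Gcd (l ` {1..n}) = 1"
    and "(\<Sum>i=1..k. int (l i) *s a i) - (\<Sum>j=k+1..n. int (l j) *s a j) = 0"
    and "relation_lattice n a =
           {\<lambda>i\<in>{1..n}. m * (if i \<le> k then int (l i) else - int (l i)) | m. m \<in> UNIV}"
    and "\<beta> \<in> complex_span n a"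
  shows "exponents' n k l a \<beta> \<noteq> {} \<and>
         (\<Sum>v \<in> exponents' n k l a \<beta>. exponent_multiplicity k v) = (\<Sum>i=1..k. l i)"
proof -
  note inj = assms(1) and indep = assms(3) and lpos = assms(6)
  let ?f = "\<lambda>i. of_int_vec (a i) :: complex ^ 'd"
  define L where "L i = (if i \<le> k then int (l i) else - int (l i))" for i
  define sol where
    "sol v \<longleftrightarrow> v \<in> extensional {1..n} \<and> (\<Sum>\<mu>=1..n. v \<mu> *s ?f \<mu>) = \<beta>" for v :: "nat \<Rightarrow> complex"

  have "(\<Sum>i=1..n. L i *s a i) = (\<Sum>i=1..k. L i *s a i) + (\<Sum>i=k+1..n. L i *s a i)"
    using \<open>k \<le> n\<close>
    by (subst sum.union_disjoint[symmetric]) (auto intro!: sum.cong)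
  also have "\<dots> = (\<Sum>i=1..k. int (l i) *s a i) - (\<Sum>j=k+1..n. int (l j) *s a j)"
    by (simp add: L_def vec_eq_iff sum_negf)
  finally have L_int: "(\<Sum>i=1..n. L i *s a i) = 0"
    using assms(8) by simp
  have L_rel: "(\<Sum>i=1..n. of_int (L i) *s ?f i) = 0"
  proof -
    have "(\<Sum>i=1..n. of_int (L i) * of_int (a i $ j)) = (0 :: complex)" for j
    proof -
      have "(\<Sum>i=1..n. L i * a i $ j) = 0"
        using arg_cong[OF L_int, of "\<lambda>v. v $ j"] by simp
      then have "of_int (\<Sum>i=1..n. L i * a i $ j) = (0 :: complex)" by (simp only: of_int_0)
      then show ?thesis by simp
    qed
    then show ?thesis by (simp add: vec_eq_iff)
  qed

  obtain v0 where v0: "sol v0"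
    using mem_complex_span_obtain[OF assms(10) inj] unfolding sol_def by metis
  define point where "point t = (\<lambda>i\<in>{1..n}. v0 i + t * of_int (L i))" for t
  have sol_point: "sol (point t)" for t
  proof -
    have "(\<Sum>\<mu>=1..n. point t \<mu> *s ?f \<mu>)
        = (\<Sum>\<mu>=1..n. v0 \<mu> *s ?f \<mu>) + t *s (\<Sum>\<mu>=1..n. of_int (L \<mu>) *s ?f \<mu>)"
      by (simp add: point_def vec.scale_left_distrib sum.distrib vec.scale_sum_right)
    then show ?thesis using v0 L_rel by (simp add: sol_def point_def)
  qed
  \<comment> \<open>the difference of two solutions agreeing at \<open>i\<close> is a relation among the other
    \<open>n - 1\<close> vectors, which are independent\<close>
  have sol_unique: "v = w" if v: "sol v" and w: "sol w" and i: "i \<in> {1..n}" "v i = w i" for v w i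
  proof
    fix x
    let ?J = "{1..n} - {i}"
    have "(\<Sum>\<mu>=1..n. (v \<mu> - w \<mu>) *s ?f \<mu>) = 0"
      using v w by (simp add: sol_def vec.scale_left_diff_distrib sum_subtractf)
    then have rel: "(\<Sum>\<mu>\<in>?J. (v \<mu> - w \<mu>) *s ?f \<mu>) = 0"
      using i by (subst (asm) sum.remove[of _ i]) auto
    have injJ: "inj_on a ?J" using inj by (rule inj_on_subset) auto
    have inj_real: "inj_on (\<lambda>i. of_int_vec (a i) :: real ^ 'd) ?J"
      using injJ unfolding inj_on_def of_int_vec_eq_iff .
    have "card ((\<lambda>i. of_int_vec (a i) :: real ^ 'd) ` ?J) = n - 1"
      unfolding card_image[OF inj_real] using i(1) by simp
    moreover have "(\<lambda>i. of_int_vec (a i) :: real ^ 'd) ` ?J \<subseteq> (\<lambda>i. of_int_vec (a i)) ` {1..n}"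
      by (rule image_mono) (rule Diff_subset)
    ultimately have "independent ((\<lambda>i. of_int_vec (a i) :: real ^ 'd) ` ?J)"
      using indep by blast
    then have "v x - w x = 0" if "x \<in> ?J"
      using complex_relation_trivial[OF _ injJ _ rel that] by simp
    moreover have "v x = w x" if "x \<notin> {1..n}"
      using v w that by (simp add: sol_def extensional_def)
    ultimately show "v x = w x" using i by auto
  qed

  interpret integral_line "{1..k}" l v0
    by unfold_locales (use lpos \<open>k \<le> n\<close> in auto)
  have coord: "point t i = coord i t" if "i \<in> {1..k}" for i t
    using that \<open>k \<le> n\<close> by (simp add: point_def coord_def L_def)
  have inj_point: "inj point"
  proof (rule injI)
    fix t s assume "point t = point s"
    then have "coord 1 t = coord 1 s" using coord[of 1] \<open>1 \<le> k\<close> by (metis atLeastAtMost_iff order_refl)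
    then show "t = s" using l_pos[of 1] \<open>1 \<le> k\<close> by (simp add: coord_def)
  qed

  have exponent: "exponent n a \<beta> i b = point t"
    if "i \<in> {1..k}" "coord i t = of_nat b" for i b t
    unfolding exponent_def
  proof (rule the_equality)
    show "point t \<in> extensional {1..n} \<and> point t i = of_nat b \<and>
        (\<Sum>\<mu>=1..n. point t \<mu> *s ?f \<mu>) = \<beta>"
      using sol_point[of t] coord that by (simp add: sol_def)
  next
    fix v assume "v \<in> extensional {1..n} \<and> v i = of_nat b \<and> (\<Sum>\<mu>=1..n. v \<mu> *s ?f \<mu>) = \<beta>"
    then show "v = point t"
      using sol_unique[OF _ sol_point[of t], of v i] coord that \<open>k \<le> n\<close> by (simp add: sol_def)
  qed
  have ex_t: "\<exists>t. coord i t = of_nat b" if "i \<in> {1..k}" for i b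
    using l_pos[OF that]
    by (intro exI[of _ "(of_nat b - v0 i) / of_nat (l i)"]) (simp add: coord_def)
  have "exponents n k l a \<beta> = point ` starts"
  proof
    show "exponents n k l a \<beta> \<subseteq> point ` starts"
    proof
      fix v assume "v \<in> exponents n k l a \<beta>"
      then obtain i b where ib: "v = exponent n a \<beta> i b" "i \<in> {1..k}" "b < l i"
        by (auto simp: exponents_def)
      obtain t where t: "coord i t = of_nat b" using ex_t[OF ib(2)] by blast
      then have "t \<in> starts" using ib unfolding starts_def by blast
      then show "v \<in> point ` starts" using exponent[OF ib(2) t] ib(1) by blast
    qed
    show "point ` starts \<subseteq> exponents n k l a \<beta>"
    proof
      fix v assume "v \<in> point ` starts"
      then obtain t i b where "v = point t" "i \<in> {1..k}" "b < l i" "coord i t = of_nat b"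
        unfolding starts_def by blast
      then show "v \<in> exponents n k l a \<beta>"
        using exponent[of i t b] unfolding exponents_def by force
    qed
  qed
  then have E': "exponents' n k l a \<beta> = point ` admissible"
    using coord unfolding exponents'_def admissible_def by auto
  have mult: "exponent_multiplicity k (point t) = card {i \<in> {1..k}. coord i t \<in> \<nat>}" for t
    using coord unfolding exponent_multiplicity_def nonneg_int_indices_def
    by (intro arg_cong[where f = card]) auto
  have total: "(\<Sum>v\<in>exponents' n k l a \<beta>. exponent_multiplicity k v) = (\<Sum>i=1..k. l i)"
    unfolding E' using inj_point sum_card_admissible
    by (subst sum.reindex) (auto simp: mult inj_on_def inj_def)
  have "0 < (\<Sum>i=1..k. l i)"
    by (rule sum_pos) (use l_pos \<open>1 \<le> k\<close> in auto)
  then have "exponents' n k l a \<beta> \<noteq> {}"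
    using total by force
  with total show ?thesis by blast
qed

end
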